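(* Let $g_1,\dots,g_m:\mathbb{R}^n\to\mathbb{R}$ be functions, let $K:=\{x\in\mathbb{R}^n : g_j(x)\le 0,\ j=1,\dots,m\}$ be closed, let $C\subseteq\mathbb{R}^n$ be a non-empty closed convex set with $C\cap K\neq\emptyset$, and put $\tilde K:=C\cap K$. Let $\bar x\in\tilde K$ and assume that each $g_j$ $(j=1,\dots,m)$ is tangentially convex at $\bar x$. Assume that $K$ is nearly convex at $\bar x$ and that the non-smooth Abadie constraint qualification holds at $\bar x$, i.e. $D(\bar x)\subseteq T_{\tilde K}(\bar x)$. Then $\{C,K\}$ has the strong conical hull intersection property (strong CHIP) at $\bar x$, i.e. $$(C\cap K-\bar x)^\circ=(C-\bar x)^\circ+(K-\bar x)^\circ.$$
   Context: Directional derivative: $f'(\bar x,\nu):=\lim_{\alpha\to0^+}\frac{f(\bar x+\alpha\nu)-f(\bar x)}{\alpha}$, if the limit exists. A function $f:\mathbb{R}^n\to\mathbb{R}$ is tangentially convex at $\bar x$ if $f'(\bar x,\cdot)$ is a real-valued convex function on $\mathbb{R}^n$ (in particular the limit exists and is finite for every direction). The tangential subdifferential is $\partial_T f(\bar x):=\{x^*\in\mathbb{R}^n : \langle x^*,\nu\rangle\le f'(\bar x,\nu)\ \forall \nu\in\mathbb{R}^n\}$. For $W\subseteq\mathbb{R}^n$, $W^\circ:=\{\lambda\in\mathbb{R}^n : \langle\lambda,y\rangle\le0\ \forall y\in W\}$, and $W-x:=\{w-x : w\in W\}$. Sums of sets are Minkowski sums. Nearly convex: a set $V\subseteq\mathbb{R}^n$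 is nearly convex at $x\in V$ if for each $y\in V$ there is a sequence $(t_k)$ of positive reals with $t_k\to0^+$ such that $x+t_k(y-x)\in V$ for all sufficiently large $k$. Contingent cone: $T_U(x)$ is the set of $x^*\in\mathbb{R}^n$ for which there exist sequences $\alpha_k>0$, $\alpha_k\to0^+$, and $x_k^*\to x^*$ with $x+\alpha_kx_k^*\in U$ for all $k\ge1$. $I(\bar x):=\{j\in\{1,\dots,m\} : g_j(\bar x)=0\}$, and $D(\bar x):=\{x^*\in\mathbb{R}^n : \langle x^*,\eta_j\rangle\le0\ \forall\eta_j\in\partial_Tg_j(\bar x),\ \forall j\in I(\bar x)\}$. *)

theory Defs
  imports "HOL-Analysis.Analysis" "HOL-Library.Set_Algebras"
begin

definition dir_quotient :: "('a::euclidean_space \<Rightarrow> real) \<Rightarrow> 'a \<Rightarrow> 'a \<Rightarrow> real \<Rightarrow> real" where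
  "dir_quotient f x v \<alpha> = (f (x + \<alpha> *\<^sub>R v) - f x) / \<alpha>"

(* Lim is a definite description: this value is meaningful only when the limit exists,
   which tangentially_convex_at demands separately for every direction. *)
definition dir_deriv :: "('a::euclidean_space \<Rightarrow> real) \<Rightarrow> 'a \<Rightarrow> 'a \<Rightarrow> real" where
  "dir_deriv f x v = Lim (at_right 0) (dir_quotient f x v)"

definition tangentially_convex_at :: "('a::euclidean_space \<Rightarrow> real) \<Rightarrow> 'a \<Rightarrow> bool" where
  "tangentially_convex_at f x \<longleftrightarrow>
     (\<forall>v. \<exists>l. (dir_quotient f x v \<longlongrightarrow> l) (at_right 0)) \<and>
     convex_on UNIV (dir_deriv f x)"

definition tangential_subdifferential :: "('a::euclidean_space \<Rightarrow> real) \<Rightarrow> 'a \<Rightarrow> 'a set" where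
  "tangential_subdifferential f x = {\<eta>. \<forall>v. \<eta> \<bullet> v \<le> dir_deriv f x v}"

definition polar :: "'a::euclidean_space set \<Rightarrow> 'a set" where
  "polar W = {l. \<forall>y\<in>W. l \<bullet> y \<le> 0}"

definition set_shift :: "'a::euclidean_space set \<Rightarrow> 'a \<Rightarrow> 'a set" where
  "set_shift W x = (\<lambda>w. w - x) ` W"

definition nearly_convex_at :: "'a::euclidean_space set \<Rightarrow> 'a \<Rightarrow> bool" where
  "nearly_convex_at V x \<longleftrightarrow>
     x \<in> V \<and>
     (\<forall>y\<in>V. \<exists>t :: nat \<Rightarrow> real. (\<forall>k. 0 < t k) \<and> t \<longlonglongrightarrow> 0 \<and>
        (\<forall>\<^sub>F k in sequentially. x + t k *\<^sub>R (y - x) \<in> V))"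

definition contingent_cone :: "'a::euclidean_space set \<Rightarrow> 'a \<Rightarrow> 'a set" where
  "contingent_cone U x =
     {d. \<exists>(\<alpha> :: nat \<Rightarrow> real) z. (\<forall>k. 0 < \<alpha> k) \<and> \<alpha> \<longlonglongrightarrow> 0 \<and> z \<longlonglongrightarrow> d \<and>
        (\<forall>k. x + \<alpha> k *\<^sub>R z k \<in> U)}"

(* The constraints are g 1, ..., g m; values of g at other indices play no role. *)
definition feasible_set :: "nat \<Rightarrow> (nat \<Rightarrow> 'a::euclidean_space \<Rightarrow> real) \<Rightarrow> 'a set" where
  "feasible_set m g = {x. \<forall>j\<in>{1..m}. g j x \<le> 0}"

definition active_indices :: "nat \<Rightarrow> (nat \<Rightarrow> 'a::euclidean_space \<Rightarrow> real) \<Rightarrow> 'a \<Rightarrow> nat set" where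
  "active_indices m g x = {j\<in>{1..m}. g j x = 0}"

definition linearized_cone :: "nat \<Rightarrow> (nat \<Rightarrow> 'a::euclidean_space \<Rightarrow> real) \<Rightarrow> 'a \<Rightarrow> 'a set" where
  "linearized_cone m g x =
     {d. \<forall>j\<in>active_indices m g x. \<forall>\<eta>\<in>tangential_subdifferential (g j) x. d \<bullet> \<eta> \<le> 0}"

definition nonsmooth_abadie_CQ ::
  "'a::euclidean_space set \<Rightarrow> nat \<Rightarrow> (nat \<Rightarrow> 'a \<Rightarrow> real) \<Rightarrow> 'a \<Rightarrow> bool" where
  "nonsmooth_abadie_CQ C m g x \<longleftrightarrow>
     linearized_cone m g x \<subseteq> contingent_cone (C \<inter> feasible_set m g) x"

(* "+" on sets is the Minkowski sum of HOL-Library.Set_Algebras. *)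
definition strong_CHIP_at :: "'a::euclidean_space set \<Rightarrow> 'a set \<Rightarrow> 'a \<Rightarrow> bool" where
  "strong_CHIP_at C K x \<longleftrightarrow>
     polar (set_shift (C \<inter> K) x) = polar (set_shift C x) + polar (set_shift K x)"

end

theory Submission
  imports Defs
begin

text \<open>
  Write \<open>x\<close> for the base point. The constraint qualification is strong enough to absorb the
  cone \<open>(C - x)\<degree>\<close> into \<open>(K - x)\<degree>\<close>: in fact \<open>(C \<inter> K - x)\<degree> = (K - x)\<degree>\<close>, so that every \<open>l\<close> on the
  left of the strong CHIP identity decomposes as \<open>0 + l\<close>.

  Indeed, if \<open>y \<in> K\<close> then near convexity supplies points of \<open>K\<close> on the segment from \<open>x\<close> to \<open>y\<close>,
  arbitrarily close to \<open>x\<close>; along them an active constraint has nonpositive difference quotients,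
  so its directional derivative in direction \<open>y - x\<close> is nonpositive, and so is the value of every
  tangential subgradient there. Hence \<open>K - x\<close> lies in the linearized cone (lemma
  \<open>nearly_convex_shift_subset_linearized_cone\<close>), which by the Abadie condition lies in
  the contingent cone of \<open>C \<inter> K\<close>. A functional that is nonpositive on \<open>C \<inter> K - x\<close> remains so on this
  contingent cone, whose elements are limits of positive multiples of elements of \<open>C \<inter> K - x\<close>
  (lemma \<open>polar_set_shift_subset_polar_contingent_cone\<close>), and therefore on \<open>K - x\<close>.
  The reverse inclusion in the strong CHIP identity is the antitonicity of polars, polars being
  closed under addition.
\<close>

lemma polar_antimono: "A \<subseteq> B \<Longrightarrow> polar B \<subseteq> polar A"
  by (auto simp: polar_def)

lemma set_shift_mono: "A \<subseteq> B \<Longrightarrow> set_shift A x \<subseteq> set_shift B x"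
  by (auto simp: set_shift_def)

lemma zero_in_polar: "0 \<in> polar W"
  by (simp add: polar_def)

lemma polar_add_closed: "a \<in> polar W \<Longrightarrow> b \<in> polar W \<Longrightarrow> a + b \<in> polar W"
  by (fastforce simp: polar_def inner_add_left intro: add_nonpos_nonpos)

lemma polar_add_subset_polar_Int:
  "polar (set_shift A x) + polar (set_shift B x) \<subseteq> polar (set_shift (A \<inter> B) x)"
proof -
  have "polar (set_shift A x) \<subseteq> polar (set_shift (A \<inter> B) x)"
    and "polar (set_shift B x) \<subseteq> polar (set_shift (A \<inter> B) x)"
    by (intro polar_antimono set_shift_mono Int_lower1 Int_lower2)+
  then show ?thesis
    by (auto simp: set_plus_def intro!: polar_add_closed)
qed

text \<open>
  The vectors \<open>z k\<close> approximating a contingent direction are positive multiples of elements of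
  \<open>U - x\<close>; nonpositivity of a linear functional survives both the scaling and the limit.
\<close>

lemma polar_set_shift_subset_polar_contingent_cone:
  "polar (set_shift U x) \<subseteq> polar (contingent_cone U x)"
proof
  fix l assume l: "l \<in> polar (set_shift U x)"
  have "l \<bullet> d \<le> 0" if d: "d \<in> contingent_cone U x" for d
  proof -
    obtain \<alpha> :: "nat \<Rightarrow> real" and z
      where pos: "\<And>k. 0 < \<alpha> k" and lim: "z \<longlonglongrightarrow> d" and mem: "\<And>k. x + \<alpha> k *\<^sub>R z k \<in> U"
      using d by (auto simp: contingent_cone_def)
    have "l \<bullet> z k \<le> 0" for k
    proof -
      have "\<alpha> k *\<^sub>R z k \<in> set_shift U x"
        using imageI[OF mem[of k], of "\<lambda>w. w - x"] by (simp add: set_shift_def)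
      then have "\<alpha> k * (l \<bullet> z k) \<le> 0"
        using l by (auto simp: polar_def)
      then show ?thesis
        using pos[of k] by (simp add: mult_le_0_iff)
    qed
    then show ?thesis
      by (intro LIMSEQ_le_const2[OF tendsto_inner[OF tendsto_const lim]]) auto
  qed
  then show "l \<in> polar (contingent_cone U x)"
    by (simp add: polar_def)
qed

lemma tangentially_convex_at_tendsto_dir_deriv:
  assumes "tangentially_convex_at f x"
  shows "(dir_quotient f x v \<longlongrightarrow> dir_deriv f x v) (at_right 0)"
  using assms tendsto_Lim[of "at_right (0::real)"]
  by (fastforce simp: tangentially_convex_at_def dir_deriv_def)

text \<open>
  Since the one-sided limit exists, its sign can be read off along any single null sequence of
  positive steps.
\<close>

lemma dir_deriv_nonpos_along_sequence:
  assumes f: "tangentially_convex_at f x"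
    and pos: "\<And>k. 0 < t k" and null: "t \<longlonglongrightarrow> 0"
    and le: "\<forall>\<^sub>F k in sequentially. f (x + t k *\<^sub>R v) \<le> f x"
  shows "dir_deriv f x v \<le> 0"
proof -
  have "filterlim t (at_right 0) sequentially"
    using null pos by (intro tendsto_imp_filterlim_at_right) auto
  then have "(\<lambda>k. dir_quotient f x v (t k)) \<longlonglongrightarrow> dir_deriv f x v"
    by (rule filterlim_compose[OF tangentially_convex_at_tendsto_dir_deriv[OF f]])
  moreover have "\<forall>\<^sub>F k in sequentially. dir_quotient f x v (t k) \<le> 0"
    using le by eventually_elim (use pos in \<open>simp add: dir_quotient_def divide_le_0_iff less_imp_le\<close>)
  ultimately show ?thesis
    by (intro tendsto_upperbound) auto
qed

text \<open>
  Tangential convexity controls difference quotients only along rays from \<open>x\<close>, so feasible points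
  that approach \<open>x\<close> along a curve need not have a limiting direction in the linearized cone. Near
  convexity provides feasible points on the ray through \<open>y\<close> itself.
\<close>

lemma nearly_convex_shift_subset_linearized_cone:
  assumes tc: "\<And>j. j \<in> active_indices m g x \<Longrightarrow> tangentially_convex_at (g j) x"
    and nc: "nearly_convex_at (feasible_set m g) x"
  shows "set_shift (feasible_set m g) x \<subseteq> linearized_cone m g x"
proof -
  have "(y - x) \<bullet> \<eta> \<le> 0"
    if y: "y \<in> feasible_set m g" and j: "j \<in> active_indices m g x"
      and \<eta>: "\<eta> \<in> tangential_subdifferential (g j) x" for y j \<eta>
  proof -
    obtain t :: "nat \<Rightarrow> real" where t: "\<And>k. 0 < t k" "t \<longlonglongrightarrow> 0"
      and ev: "\<forall>\<^sub>F k in sequentially. x + t k *\<^sub>R (y - x) \<in> feasible_set m g"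
      using nc y unfolding nearly_convex_at_def by blast
    from ev have "\<forall>\<^sub>F k in sequentially. g j (x + t k *\<^sub>R (y - x)) \<le> g j x"
      by eventually_elim (use j in \<open>simp add: feasible_set_def active_indices_def\<close>)
    with tc[OF j] t have "dir_deriv (g j) x (y - x) \<le> 0"
      by (rule dir_deriv_nonpos_along_sequence)
    moreover have "\<eta> \<bullet> (y - x) \<le> dir_deriv (g j) x (y - x)"
      using \<eta> by (simp add: tangential_subdifferential_def)
    ultimately show ?thesis
      by (simp add: inner_commute)
  qed
  then show ?thesis
    by (auto simp: set_shift_def linearized_cone_def)
qed

theorem corollary3p1:
  fixes g :: "nat \<Rightarrow> real ^ 'n \<Rightarrow> real" and m :: nat
    and C K :: "(real ^ 'n) set" and xbar :: "real ^ 'n"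
  assumes K: "K = feasible_set m g"
    and "closed K"
    and "C \<noteq> {}" and "closed C" and "convex C"
    and "C \<inter> K \<noteq> {}"
    and "xbar \<in> C \<inter> K"
    and "\<And>j. j \<in> {1..m} \<Longrightarrow> tangentially_convex_at (g j) xbar"
    and "nearly_convex_at K xbar"
    and "nonsmooth_abadie_CQ C m g xbar"
  shows "strong_CHIP_at C K xbar"
proof -
  have "set_shift K xbar \<subseteq> linearized_cone m g xbar"
    unfolding K using assms(8,9)
    by (intro nearly_convex_shift_subset_linearized_cone) (auto simp: K active_indices_def)
  also have "\<dots> \<subseteq> contingent_cone (C \<inter> K) xbar"
    using assms(10) by (simp add: nonsmooth_abadie_CQ_def K)
  finally have "polar (set_shift (C \<inter> K) xbar) \<subseteq> polar (set_shift K xbar)"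
    by (meson polar_antimono polar_set_shift_subset_polar_contingent_cone subset_trans)
  also have "\<dots> \<subseteq> polar (set_shift C xbar) + polar (set_shift K xbar)"
    using set_zero_plus2[OF zero_in_polar] .
  finally show ?thesis
    unfolding strong_CHIP_at_def by (intro subset_antisym polar_add_subset_polar_Int)
qed

end
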